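(* Let $q$ be a prime power, let $n,r$ be integers with $1\le r\le n-1$, and let $d=\gcd(n,r)$. Let $a\in\mathbb{F}_{q^n}$ with $a\neq 0$, and let $L_r(x)=x^{q^r}+ax\in\mathbb{F}_{q^n}[x]$. Assume that $(-1)^{n/d}\,a^{(q^n-1)/(q^d-1)}\neq 1$ (so that $L_r(x)$ is a permutation polynomial over $\mathbb{F}_{q^n}$). Then the compositional inverse of $L_r(x)$ over $\mathbb{F}_{q^n}$ is \[L_r^{-1}(x)=\frac{\mathrm{N}_{n:d}(a)}{\mathrm{N}_{n:d}(a)+(-1)^{\frac{n}{d}-1}}\sum_{i=0}^{\frac{n}{d}-1}(-1)^i a^{-\frac{q^{(i+1)r}-1}{q^r-1}}x^{q^{ir}}.\]
   Context: $\mathbb{F}_{q^n}$ denotes the finite field with $q^n$ elements. A polynomial over $\mathbb{F}_{q^n}$ is a permutation polynomial if the map it induces from $\mathbb{F}_{q^n}$ to itself is bijective. For a permutation polynomial $f(x)$ over $\mathbb{F}_{q^n}$, its compositional inverse $f^{-1}(x)$ is the polynomial over $\mathbb{F}_{q^n}$ inducing the inverse of the map induced by $f$, i.e. $f(f^{-1}(x))\equiv f^{-1}(f(x))\equiv x \pmod{x^{q^n}-x}$; it is determined modulo $x^{q^n}-x$, and equalities for $f^{-1}(x)$ are understood modulo $x^{q^n}-x$. For a divisor $l$ of $n$, $\mathrm{N}_{n:l}(x)=x^{(q^n-1)/(q^l-1)}$ is the norm map from $\mathbb{F}_{q^n}$ to $\mathbb{F}_{q^l}$. *)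

theory Defs
  imports
    "HOL-Computational_Algebra.Polynomial"
    "HOL-Number_Theory.Cong"
    "HOL-Number_Theory.Prime_Powers"
    "HOL-Library.Cardinality"
begin

text \<open>
  The field with \<open>q ^ n\<close> elements is modelled by an arbitrary type \<open>'a :: {field, finite}\<close>
  with \<open>CARD('a) = q ^ n\<close>.
\<close>

definition permutation_poly :: "'a::{field,finite} poly \<Rightarrow> bool" where
  "permutation_poly f \<longleftrightarrow> bij (poly f)"

definition field_poly :: "'a::{field,finite} poly" where
  "field_poly = monom 1 CARD('a) - monom 1 1"

text \<open>
  A compositional inverse is only determined modulo \<open>field_poly\<close>, hence a relation.
\<close>

definition compositional_inverse :: "'a::{field,finite} poly \<Rightarrow> 'a poly \<Rightarrow> bool" where
  "compositional_inverse f g \<longleftrightarrow>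
     [f \<circ>\<^sub>p g = monom 1 1] (mod field_poly) \<and> [g \<circ>\<^sub>p f = monom 1 1] (mod field_poly)"

text \<open>
  Meant for \<open>l\<close> dividing \<open>n\<close>, in which case the division of naturals is exact. The values lie in
  the subfield with \<open>q ^ l\<close> elements, and are regarded here as elements of the large field.
\<close>

definition norm_map :: "nat \<Rightarrow> nat \<Rightarrow> nat \<Rightarrow> 'a::{field,finite} \<Rightarrow> 'a" where
  "norm_map q n l x = x ^ ((q ^ n - 1) div (q ^ l - 1))"

definition linearized_binomial :: "nat \<Rightarrow> nat \<Rightarrow> 'a::{field,finite} \<Rightarrow> 'a poly" where
  "linearized_binomial q r a = monom 1 (q ^ r) + monom a 1"

end

theory Submission
  imports Defs
begin

text \<open>
  Write \<open>Q = q ^ r\<close> and \<open>m = n div d\<close>. Congruence modulo \<open>field_poly\<close> is equality of the induced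
  maps (\<open>cong_field_poly_iff\<close>), and on a finite set a one-sided inverse is two-sided, so it suffices
  to check that the stated polynomial, evaluated at any \<open>x\<close>, is sent to \<open>x\<close> by the map
  \<open>y \<mapsto> y ^ Q + a * y\<close> (\<open>permutation_poly_and_inverse_unique\<close>).

  Let \<open>S\<close> be the sum in the formula, without the scalar in front. As \<open>y \<mapsto> y ^ Q\<close> is additive, each
  term of \<open>S ^ Q\<close> cancels against the next term of \<open>a * S\<close>, leaving
  \<open>x - (- 1) ^ m * inverse (a ^ (1 + Q + \<dots> + Q ^ (m - 1))) ^ Q * x ^ (Q ^ m)\<close>
  (\<open>linearized_binomial_telescope\<close>). Three facts turn this into a constant multiple of \<open>x\<close>:
  \<^item> \<open>n\<close> divides \<open>r * m\<close>, so \<open>x ^ (Q ^ m) = x\<close>;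
  \<^item> the exponents \<open>j * r\<close> with \<open>j < m\<close> run modulo \<open>n\<close> through the multiples of \<open>d\<close>, so
    \<open>a ^ (1 + Q + \<dots> + Q ^ (m - 1))\<close> is the norm \<open>N\<close> of \<open>a\<close> (\<open>power_geometric_sum_gcd\<close>);
  \<^item> \<open>N\<close> lies in the subfield with \<open>q ^ d\<close> elements, so \<open>N ^ Q = N\<close> (\<open>norm_map_power\<close>).

  The result is \<open>(1 + (- 1) ^ (m - 1) / N) * x\<close>. The hypothesis on \<open>a\<close> says that this factor is
  nonzero; its inverse is the scalar in the formula. That scalar is fixed by \<open>y \<mapsto> y ^ Q\<close>
  as well, so it can be pulled out of the linearized binomial.
\<close>

section \<open>Polynomials as maps on a finite field\<close>

text \<open>
  Multiplication by a nonzero \<open>x\<close> permutes the nonzero elements. Comparing the products of all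
  nonzero elements before and after gives \<open>x ^ (CARD('a) - 1) = 1\<close>.
\<close>

lemma power_CARD_eq_self:
  fixes x :: "'a::{field,finite}"
  shows "x ^ CARD('a) = x"
proof (cases "x = 0")
  case False
  have "bij_betw ((*) x) (UNIV - {0}) (UNIV - {0})"
    by (rule bij_betw_byWitness[where f' = "\<lambda>y. y / x"]) (use False in auto)
  then have "(\<Prod>y\<in>UNIV - {0}. x * y) = \<Prod>(UNIV - {0})"
    by (rule prod.reindex_bij_betw)
  then have "x ^ (CARD('a) - 1) * \<Prod>(UNIV - {0 :: 'a}) = \<Prod>(UNIV - {0 :: 'a})"
    by (simp add: prod.distrib card_Diff_singleton)
  then have "x ^ (CARD('a) - 1) = 1"
    by simp
  then show ?thesis
    using power_minus_mult[of "CARD('a)" x] by (simp add: zero_less_card_finite)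
qed (simp add: zero_less_card_finite)

lemma power_CARD_power_eq_self:
  fixes x :: "'a::{field,finite}"
  shows "x ^ (CARD('a) ^ k) = x"
  by (induction k) (simp_all add: power_mult power_CARD_eq_self)

lemma CARD_field_gt_1: "CARD('a::{field,finite}) > 1"
proof -
  have "card {0, 1 :: 'a} \<le> CARD('a)"
    by (rule card_mono) auto
  then show ?thesis
    by simp
qed

lemma degree_field_poly: "degree (field_poly :: 'a::{field,finite} poly) = CARD('a)"
proof -
  have "degree (- monom 1 1 :: 'a poly) < degree (monom 1 CARD('a) :: 'a poly)"
    using CARD_field_gt_1[where 'a = 'a] by (simp add: degree_monom_eq)
  from degree_add_eq_left[OF this] show ?thesis
    by (simp add: field_poly_def degree_monom_eq)
qed

text \<open>
  A remainder modulo \<open>field_poly\<close> has degree less than the number of elements of the field, so it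
  is determined by its values.
\<close>

lemma cong_field_poly_iff:
  fixes f g :: "'a::{field,finite} poly"
  shows "[f = g] (mod field_poly) \<longleftrightarrow> poly f = poly g"
proof
  have zero: "poly field_poly x = 0" for x :: 'a
    by (simp add: field_poly_def poly_monom power_CARD_eq_self)
  have mod_eq: "poly (h mod field_poly) x = poly h x" for h and x :: 'a
    by (simp add: poly_mod zero)
  show "poly f = poly g" if "[f = g] (mod field_poly)"
    using that mod_eq unfolding cong_def by (metis ext)
  assume eq: "poly f = poly g"
  have deg: "degree (h mod field_poly) < CARD('a)" for h :: "'a poly"
  proof -
    have "field_poly \<noteq> (0 :: 'a poly)"
      using degree_field_poly[where 'a = 'a] CARD_field_gt_1[where 'a = 'a] by auto
    from degree_mod_less[OF this, of h] show ?thesis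
      using CARD_field_gt_1[where 'a = 'a] by (auto simp: degree_field_poly)
  qed
  show "[f = g] (mod field_poly)"
    unfolding cong_def
    by (rule poly_eqI_degree[where A = UNIV]) (simp_all add: mod_eq eq deg)
qed

lemma compositional_inverse_iff:
  "compositional_inverse f g \<longleftrightarrow>
     (\<forall>x. poly f (poly g x) = x) \<and> (\<forall>x. poly g (poly f x) = x)"
  by (simp add: compositional_inverse_def cong_field_poly_iff fun_eq_iff poly_pcompose poly_monom)

text \<open>A surjective self-map of a finite set is bijective, so a right inverse is the inverse.\<close>

lemma permutation_poly_and_inverse_unique:
  fixes f h :: "'a::{field,finite} poly"
  assumes right_inverse: "\<And>x. poly f (poly h x) = x"
  shows "permutation_poly f \<and> (\<forall>g. compositional_inverse f g \<longleftrightarrow> [g = h] (mod field_poly))"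
proof -
  have "surj (poly f)"
    using right_inverse by (rule surjI)
  then have inj: "inj (poly f)"
    by (rule finite_UNIV_surj_inj[OF finite])
  have left_inverse: "poly h (poly f x) = x" for x
    by (rule injD[OF inj]) (rule right_inverse)
  have "compositional_inverse f g \<longleftrightarrow> [g = h] (mod field_poly)" for g
    unfolding compositional_inverse_iff cong_field_poly_iff fun_eq_iff
    by (metis right_inverse left_inverse)
  then show ?thesis
    using \<open>surj (poly f)\<close> inj by (simp add: permutation_poly_def bij_def)
qed

section \<open>Powers of the characteristic\<close>

lemma prime_CHAR_finite_field: "prime CHAR('a::{field,finite})"
  by (rule prime_CHAR_semidom) (rule finite_imp_CHAR_pos[OF finite])

text \<open>Adding \<open>1\<close> permutes the elements, so it leaves their sum unchanged: \<open>of_nat CARD('a) = 0\<close>.\<close>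

lemma CHAR_dvd_CARD_finite: "CHAR('a) dvd CARD('a::{ring_1,finite})"
proof -
  have "bij_betw (\<lambda>y :: 'a. y + 1) UNIV UNIV"
    by (rule bij_betw_byWitness[where f' = "\<lambda>y. y - 1"]) auto
  then have "(\<Sum>y\<in>UNIV. y + 1) = \<Sum>(UNIV :: 'a set)"
    by (rule sum.reindex_bij_betw)
  then have "of_nat CARD('a) = (0 :: 'a)"
    by (simp add: sum.distrib)
  then show ?thesis
    by (simp add: of_nat_eq_0_iff_char_dvd)
qed

lemma primepow_root_CARD_eq_CHAR_power:
  assumes "primepow q" and "CARD('a::{field,finite}) = q ^ n"
  obtains k where "q = CHAR('a) ^ k"
proof -
  obtain p k where p: "prime p" and q: "q = p ^ k"
    using assms(1) by (auto simp: primepow_def)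
  have "CHAR('a) dvd q ^ n"
    using CHAR_dvd_CARD_finite[where 'a = 'a] by (simp add: assms(2))
  then have "CHAR('a) dvd p"
    using prime_CHAR_finite_field[where 'a = 'a] by (auto simp: q dest: prime_dvd_power)
  then have "CHAR('a) = p"
    using p prime_CHAR_finite_field[where 'a = 'a] by (simp add: primes_dvd_imp_eq)
  with q show ?thesis
    by (intro that) simp
qed

text \<open>In characteristic 2 the exponent is even for positive \<open>k\<close>, but there \<open>- 1 = 1\<close>.\<close>

lemma minus_one_power_CHAR_power:
  assumes "prime CHAR('a::comm_ring_1)"
  shows "(- 1 :: 'a) ^ (CHAR('a) ^ k) = - 1"
  by (induction k) (simp_all add: power_mult minus_power_prime_CHAR[OF refl assms])

text \<open>
  The sum is a telescope in disguise. Since \<open>E (i + 1) = 1 + Q * E i\<close>, the term of index \<open>i\<close>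
  in \<open>a * S\<close> is \<open>(- 1) ^ i * inverse (a ^ (Q * E i)) * x ^ (Q ^ i)\<close>, and the one in \<open>S ^ Q\<close>
  is the negative of the same expression at \<open>i + 1\<close>.
\<close>

lemma linearized_binomial_telescope:
  fixes a x :: "'a::field" and m :: nat
  assumes char: "prime CHAR('a)" and Q: "Q = CHAR('a) ^ k" and a: "a \<noteq> 0"
  defines "E \<equiv> \<lambda>i. \<Sum>j<i. Q ^ j"
  defines "S \<equiv> \<Sum>i<m. (- 1) ^ i * inverse (a ^ E (i + 1)) * x ^ (Q ^ i)"
  shows "S ^ Q + a * S = x - (- 1) ^ m * inverse (a ^ E m) ^ Q * x ^ (Q ^ m)"
proof -
  define U where "U i = (- 1) ^ i * inverse (a ^ E i) ^ Q * x ^ (Q ^ i)" for i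
  have E_Suc: "E (Suc i) = 1 + E i * Q" for i
    by (simp add: E_def sum.lessThan_Suc_shift sum_distrib_right mult.commute[of Q]
        del: sum.lessThan_Suc)
  have sign: "((- 1 :: 'a) ^ i) ^ Q = (- 1) ^ i" for i
    by (metis Q char minus_one_power_CHAR_power mult.commute power_mult)
  have "S ^ Q = (\<Sum>i<m. ((- 1) ^ i * inverse (a ^ E (i + 1)) * x ^ (Q ^ i)) ^ Q)"
    unfolding S_def using char Q by (rule freshmans_dream_sum')
  also have "\<dots> = (\<Sum>i<m. - U (Suc i))"
    by (simp add: U_def power_mult_distrib sign power_mult[of x, symmetric] mult.commute[of Q])
  finally have frob: "S ^ Q = (\<Sum>i<m. - U (Suc i))" .
  have "a * ((- 1) ^ i * inverse (a ^ E (i + 1)) * x ^ (Q ^ i)) = U i" for i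
    using a by (simp add: U_def E_Suc power_mult power_inverse)
  then have "a * S = (\<Sum>i<m. U i)"
    by (simp add: S_def sum_distrib_left)
  with frob have "S ^ Q + a * S = (\<Sum>i<m. U i - U (Suc i))"
    by (simp add: sum_subtractf sum_negf)
  also have "\<dots> = U 0 - U m"
    by (rule sum_lessThan_telescope')
  finally show ?thesis
    using Q char by (simp add: U_def E_def)
qed

section \<open>The norm as a power product\<close>

lemma geometric_sum_nat:
  fixes Q :: nat
  assumes "Q > 0"
  shows "(Q - 1) * (\<Sum>j<m. Q ^ j) = Q ^ m - 1"
proof (induction m)
  case (Suc m)
  have "Q ^ m \<ge> 1" "Q * Q ^ m \<ge> Q ^ m"
    using assms by simp_all
  with Suc show ?case
    by (simp add: distrib_left diff_mult_distrib)
qed simp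

lemma geometric_sum_nat_div:
  fixes Q :: nat
  assumes "Q > 1"
  shows "(Q ^ m - 1) div (Q - 1) = (\<Sum>j<m. Q ^ j)"
  using geometric_sum_nat[of Q m, symmetric] assms by simp

lemma bij_betw_mult_mod_coprime:
  fixes k m :: nat
  assumes "coprime k m"
  shows "bij_betw (\<lambda>j. j * k mod m) {..<m} {..<m}"
proof -
  have "inj_on (\<lambda>j. j * k mod m) {..<m}"
  proof (rule inj_onI)
    fix i j assume ij: "i \<in> {..<m}" "j \<in> {..<m}" and "i * k mod m = j * k mod m"
    then have "[i * k = j * k] (mod m)"
      by (simp add: cong_def)
    then have "[i = j] (mod m)"
      using assms by (simp add: cong_mult_rcancel_nat)
    with ij show "i = j"
      by (simp add: cong_less_modulus_unique_nat)
  qed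
  moreover have "(\<lambda>j. j * k mod m) ` {..<m} \<subseteq> {..<m}"
    by auto
  ultimately show ?thesis
    by (simp add: bij_betw_def endo_inj_surj)
qed

text \<open>
  Both sides are products of conjugates \<open>a ^ (q ^ e)\<close>, and such a conjugate depends only on \<open>e\<close>
  modulo \<open>n\<close>. With \<open>m = n div gcd n r\<close> and \<open>j < m\<close>, the exponents \<open>r * j\<close> are, modulo \<open>n\<close>, the
  multiples \<open>gcd n r * i\<close> with \<open>i < m\<close> in another order, because \<open>r div gcd n r\<close> is coprime to \<open>m\<close>.
\<close>

lemma power_geometric_sum_gcd:
  fixes a :: "'a::{field,finite}"
  assumes card: "CARD('a) = q ^ n" and "n > 0" and d: "d = gcd n r"
  shows "a ^ (\<Sum>j<n div d. (q ^ r) ^ j) = a ^ (\<Sum>j<n div d. (q ^ d) ^ j)"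
proof -
  define m k where "m = n div d" and "k = r div d"
  have n: "n = d * m" and r: "r = d * k"
    by (simp_all add: m_def k_def d)
  have "coprime k m"
    unfolding m_def k_def d using \<open>n > 0\<close> by (metis coprime_commute div_gcd_coprime less_irrefl)
  have period: "a ^ (q ^ (n * c + e)) = a ^ (q ^ e)" for c e
    using power_CARD_power_eq_self[of a c]
    by (simp add: power_add power_mult card)
  have conj: "a ^ ((q ^ r) ^ j) = a ^ ((q ^ d) ^ (j * k mod m))" for j
  proof -
    have "r * j = d * (m * (j * k div m) + j * k mod m)"
      by (simp only: mult_div_mod_eq r mult.assoc mult.commute[of k])
    also have "\<dots> = n * (j * k div m) + d * (j * k mod m)"
      unfolding n by (simp only: distrib_left mult.assoc)
    finally show ?thesis
      using period[of "j * k div m" "d * (j * k mod m)"] by (simp flip: power_mult)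
  qed
  have "a ^ (\<Sum>j<m. (q ^ r) ^ j) = (\<Prod>j<m. a ^ ((q ^ d) ^ (j * k mod m)))"
    by (simp add: power_sum conj)
  also have "\<dots> = (\<Prod>j<m. a ^ ((q ^ d) ^ j))"
    by (rule prod.reindex_bij_betw[OF bij_betw_mult_mod_coprime[OF \<open>coprime k m\<close>],
          of "\<lambda>i. a ^ ((q ^ d) ^ i)"])
  finally show ?thesis
    by (simp add: power_sum m_def)
qed

text \<open>
  The factors \<open>q ^ d - 1\<close> and \<open>(q ^ n - 1) div (q ^ d - 1)\<close> multiply to the order of the
  multiplicative group, so \<open>N ^ (q ^ d - 1) = 1\<close> for the norm \<open>N\<close>; hence the power map
  \<open>y \<mapsto> y ^ (q ^ d)\<close> and its iterates fix \<open>N\<close>.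
\<close>

lemma norm_map_power:
  fixes a :: "'a::{field,finite}"
  assumes card: "CARD('a) = q ^ n" and "q > 0" and "a \<noteq> 0" and "d dvd n" and "d dvd r"
  shows "norm_map q n d a ^ (q ^ r) = norm_map q n d a"
proof -
  define N where "N = norm_map q n d a"
  obtain m where m: "n = d * m"
    using \<open>d dvd n\<close> by (auto elim: dvdE)
  obtain k where k: "r = d * k"
    using \<open>d dvd r\<close> by (auto elim: dvdE)
  have "(q ^ d - 1) dvd (q ^ n - 1)"
    using geometric_sum_nat[of "q ^ d" m] \<open>q > 0\<close> by (metis dvd_triv_left m power_mult zero_less_power)
  then have "N ^ (q ^ d - 1) = a ^ (q ^ n - 1)"
    unfolding N_def norm_map_def power_mult[symmetric] by simp
  moreover have "a * a ^ (q ^ n - 1) = a"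
    using power_CARD_eq_self[of a] \<open>q > 0\<close> by (simp add: card flip: power_Suc)
  ultimately have "N ^ (q ^ d - 1) = 1"
    using \<open>a \<noteq> 0\<close> by simp
  then have fixed: "N ^ (q ^ d) = N"
    using power_minus_mult[of "q ^ d" N] \<open>q > 0\<close> by simp
  have "N ^ ((q ^ d) ^ k) = N"
    by (induction k) (simp_all add: power_mult fixed)
  then show ?thesis
    by (simp add: N_def k power_mult)
qed

section \<open>The inverse of a linearized binomial\<close>

theorem theorem2p1:
  fixes q n r d :: nat and a :: "'a::{field,finite}"
  assumes "primepow q"
    and "CARD('a) = q ^ n"
    and "1 \<le> r" and "r \<le> n - 1"
    and "d = gcd n r"
    and "a \<noteq> 0"
    and "(- 1) ^ (n div d) * a ^ ((q ^ n - 1) div (q ^ d - 1)) \<noteq> 1"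
  shows "permutation_poly (linearized_binomial q r a) \<and>
    (\<forall>g. compositional_inverse (linearized_binomial q r a) g \<longleftrightarrow>
      [g = smult (norm_map q n d a / (norm_map q n d a + (- 1) ^ (n div d - 1)))
            (\<Sum>i = 0..n div d - 1.
              monom ((- 1) ^ i * inverse (a ^ ((q ^ ((i + 1) * r) - 1) div (q ^ r - 1))))
                (q ^ (i * r)))]
        (mod field_poly))"
proof -
  define Q m N where "Q = q ^ r" and "m = n div d" and "N = norm_map q n d a"
  define c where "c = N / (N + (- 1) ^ (m - 1))"
  define E where "E i = (\<Sum>j<i. Q ^ j)" for i
  define h where "h = smult c
    (\<Sum>i = 0..m - 1. monom ((- 1) ^ i * inverse (a ^ ((q ^ ((i + 1) * r) - 1) div (q ^ r - 1))))
       (q ^ (i * r)))"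
  have "n > 0"
    using assms(3,4) by linarith
  then have "d > 0" "m > 0"
    using assms(5) by (simp_all add: m_def div_greater_zero_iff dvd_imp_le)
  have "d dvd n" "d dvd r"
    using assms(5) by simp_all
  have "q > 1"
    using primepow_gt_Suc_0[OF assms(1)] by simp
  then have "Q > 1" "q ^ d > 1"
    using assms(3) \<open>d > 0\<close> unfolding Q_def by (intro one_less_power; simp)+
  have char: "prime CHAR('a)"
    by (rule prime_CHAR_finite_field)
  obtain k where "q = CHAR('a) ^ k"
    using primepow_root_CARD_eq_CHAR_power[OF assms(1,2)] .
  then have Q: "Q = CHAR('a) ^ (k * r)"
    by (simp add: Q_def power_mult)

  have norm_E: "a ^ E m = N"
  proof -
    have "(q ^ n - 1) div (q ^ d - 1) = (\<Sum>j<m. (q ^ d) ^ j)"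
      using geometric_sum_nat_div[OF \<open>q ^ d > 1\<close>, of m] \<open>d dvd n\<close>
      by (simp add: m_def flip: power_mult)
    then show ?thesis
      using power_geometric_sum_gcd[OF assms(2) \<open>n > 0\<close> assms(5), of a]
      by (simp add: N_def norm_map_def E_def Q_def m_def)
  qed
  have N_fixed: "N ^ Q = N"
    unfolding N_def Q_def using \<open>q > 1\<close> assms(2,6) \<open>d dvd n\<close> \<open>d dvd r\<close>
    by (intro norm_map_power) simp_all
  have "N \<noteq> 0"
    using assms(6) by (simp add: N_def norm_map_def)
  have sign: "(- 1 :: 'a) ^ m = - ((- 1) ^ (m - 1))"
    using \<open>m > 0\<close> by (cases m) simp_all
  have denom: "N + (- 1) ^ (m - 1) \<noteq> 0"
  proof
    assume "N + (- 1) ^ (m - 1) = 0"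
    then have "N = (- 1) ^ m"
      by (simp add: sign eq_neg_iff_add_eq_0)
    then have "(- 1) ^ m * N = 1"
      by (simp flip: power_mult_distrib)
    with assms(7) show False
      by (simp add: N_def m_def norm_map_def)
  qed
  have c_fixed: "c ^ Q = c"
  proof -
    have "((- 1 :: 'a) ^ (m - 1)) ^ Q = (- 1) ^ (m - 1)"
      by (metis Q char minus_one_power_CHAR_power mult.commute power_mult)
    then show ?thesis
      by (simp add: c_def power_divide N_fixed freshmans_dream'[OF char Q])
  qed

  have "poly (linearized_binomial q r a) (poly h x) = x" for x
  proof -
    define S where "S = (\<Sum>i<m. (- 1) ^ i * inverse (a ^ E (i + 1)) * x ^ (Q ^ i))"
    have range: "{0..m - 1} = {..<m}"
      using \<open>m > 0\<close> by auto
    have expo: "(q ^ ((i + 1) * r) - 1) div (q ^ r - 1) = E (i + 1)" for i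
      using geometric_sum_nat_div[OF \<open>Q > 1\<close>, of "i + 1"]
      unfolding E_def Q_def by (simp only: power_mult mult.commute[of _ r])
    have "poly h x = c * S"
      unfolding h_def S_def range expo
      by (simp add: poly_sum poly_monom Q_def mult.commute[of _ r] power_mult)
    then have "poly (linearized_binomial q r a) (poly h x) = c * (S ^ Q + a * S)"
      by (simp add: linearized_binomial_def poly_monom power_mult_distrib c_fixed algebra_simps
          flip: Q_def)
    also have "S ^ Q + a * S = x - (- 1) ^ m * inverse (a ^ E m) ^ Q * x ^ (Q ^ m)"
      unfolding S_def E_def using char Q assms(6) by (rule linearized_binomial_telescope)
    also have "x ^ (Q ^ m) = x"
    proof -
      have "r * m = n * (r div d)"
        using \<open>d dvd n\<close> \<open>d dvd r\<close> by (metis m_def div_mult_swap dvd_div_mult mult.commute)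
      then show ?thesis
        using power_CARD_power_eq_self[of x "r div d"]
        by (simp add: Q_def assms(2) flip: power_mult)
    qed
    also have "x - (- 1) ^ m * inverse (a ^ E m) ^ Q * x = (N + (- 1) ^ (m - 1)) / N * x"
      using \<open>N \<noteq> 0\<close> by (simp add: norm_E N_fixed power_inverse sign field_simps)
    also have "c * \<dots> = x"
      using denom \<open>N \<noteq> 0\<close> by (simp add: c_def)
    finally show ?thesis .
  qed
  then have "permutation_poly (linearized_binomial q r a) \<and>
      (\<forall>g. compositional_inverse (linearized_binomial q r a) g \<longleftrightarrow> [g = h] (mod field_poly))"
    by (rule permutation_poly_and_inverse_unique)
  then show ?thesis
    unfolding h_def c_def N_def m_def .
qed

end
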